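(* Let $n\geqslant 2$, let $f_N\in\mathbb{R}[\bar{x}]$, $\bar{x}=(x_1,\ldots,x_{n-1})^{\top}$, be the sample average polynomial defined in the context, let $d_0=\lceil\deg(f_N)/2\rceil\geqslant 1$, and let $g=(g_1,\ldots,g_n)=(x_1,\ldots,x_{n-1},1-\bar{e}^{\top}\bar{x})$. Let $\varepsilon>0$ be given. Consider the optimization problem $$(P)\quad \min_{\bar{x}\in\mathbb{R}^{n-1}}\ f_N(\bar{x})+\varepsilon\|[\bar{x}]_{2d_0}\|\quad\text{s.t.}\quad \bar{x}\geqslant 0,\ 1-\bar{e}^{\top}\bar{x}\geqslant 0,$$ and its moment relaxation $$(R)\quad \min_{y\in\mathbb{R}^{\mathbb{N}^{n-1}_{2d_0}}}\ \langle f_N,y\rangle+\varepsilon\|y\|\quad\text{s.t.}\quad y_0=1,\ M_{d_0}[y]\succeq 0,\ L_{g_i}^{(d_0)}[y]\succeq 0\ (i=1,\ldots,n).$$ Suppose $(R)$ is solvable with a global minimizer $y^*$. Then $(R)$ is a tight relaxation of $(P)$ (that is, $(R)$ and $(P)$ have the same optimal value) if and only if $\operatorname{rank} M_{d_0}[y^*]=1$. Moreover, if $\operatorname{rank} M_{d_0}[y^*]=1$, then $u=(y^*_{e_1},\ldots,y^*_{e_{n-1}})^{\top}$ is a global minimizer of $(P)$.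
   Context: Notation: $\bar{e}=(1,\ldots,1)^{\top}\in\mathbb{R}^{n-1}$; $e_i\in\mathbb{N}^{n-1}$ is the $i$th standard unit vector; $\|\cdot\|$ is the Euclidean norm; $A\succeq 0$ means the symmetric matrix $A$ is positive semidefinite; $\mathbb{R}[\bar{x}]_k$ is the set of real polynomials in $\bar{x}$ of degree at most $k$. For an integer $k\geqslant 0$, $\mathbb{N}^{n-1}_k=\{\alpha\in\mathbb{N}^{n-1}:\alpha_1+\cdots+\alpha_{n-1}\leqslant k\}$, $\bar{x}^{\alpha}=x_1^{\alpha_1}\cdots x_{n-1}^{\alpha_{n-1}}$, and $[\bar{x}]_k=(\bar{x}^{\alpha})_{\alpha\in\mathbb{N}^{n-1}_k}$ is the vector of all monomials of degree at most $k$. A truncated multi-sequence is a real vector $y=(y_\alpha)_{\alpha\in\mathbb{N}^{n-1}_{2d_0}}\in\mathbb{R}^{\mathbb{N}^{n-1}_{2d_0}}$, and $y_0$ denotes its entry at $\alpha=0$. For $p=\sum_\alpha p_\alpha\bar{x}^\alpha\in\mathbb{R}[\bar{x}]_{2d_0}$, $\langle p,y\rangle:=\sum_\alpha p_\alpha y_\alpha$. For a polynomial $q$ with $t_0=\lceil\deg(q)/2\rceil\leqslant d_0$, the localizing matrix $L_q^{(d_0)}[y]$ is the symmetric matrix, with rows and columns indexed by $\mathbb{N}^{n-1}_{d_0-t_0}$, such that $\mathrm{vec}(a)^{\top}L_q^{(d_0)}[y]\,\mathrm{vec}(b)=\langle qab,y\rangle$ for all $a,b\in\mathbb{R}[\bar{x}]_{d_0-t_0}$,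 where $\mathrm{vec}(\cdot)$ is the coefficient vector. The moment matrix is $M_{d_0}[y]:=L_1^{(d_0)}[y]$, i.e. its $(\alpha,\beta)$ entry is $y_{\alpha+\beta}$ for $\alpha,\beta\in\mathbb{N}^{n-1}_{d_0}$. The polynomial $f_N$: $\xi$ is a random vector in $\mathbb{R}^n$ with finite mean, $\xi^{(1)},\ldots,\xi^{(N)}\in\mathbb{R}^n$ are given samples of $\xi$, and $f_N(\bar{x})=\frac1N\sum_{i=1}^N F((\bar{x},1-\bar{e}^{\top}\bar{x}),\xi^{(i)})$. Here, for a fixed integer $d\geqslant 2$ and weights $\lambda_1,\ldots,\lambda_d\geqslant 0$ with $\lambda_1+\cdots+\lambda_d=1$, $F(x,\xi)=-\lambda_1 r(x,\xi)+\sum_{i=2}^d(-1)^i\lambda_i r_i(x,\xi)$, with $r(x,\xi)=x^{\top}\xi$ and $r_i(x,\xi)=(x^{\top}\xi-x^{\top}\mathbb{E}[\xi])^i$. *)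

theory Defs
  imports
    "HOL-Probability.Probability"
    "HOL-Library.Poly_Mapping"
    "Jordan_Normal_Form.DL_Rank"
begin

no_notation Matrix.vec_index (infixl "$" 100)

text \<open>
  Conventions. The index type \<open>'m\<close> is finite (and nonempty) and plays the role of
  \<open>{1,...,n-1}\<close>; the type \<open>'m option\<close> plays the role of \<open>{1,...,n}\<close>, with \<open>None\<close> as the
  last index \<open>n\<close>. Hence \<open>n = CARD('m option) = CARD('m) + 1 \<ge> 2\<close>.
  Multi-indices are elements of \<open>nat ^ 'm\<close>, and polynomials in \<open>n - 1\<close> variables are the
  elements of the monoid algebra of multi-indices; \<open>axis i 1\<close> is the unit vector \<open>e\<^sub>i\<close>.
\<close>

type_synonym 'm mpoly = "(nat ^ 'm) \<Rightarrow>\<^sub>0 real"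

section \<open>Polynomials\<close>

definition mdeg :: "nat ^ 'm \<Rightarrow> nat" where
  "mdeg \<alpha> = (\<Sum>i\<in>UNIV. \<alpha> $ i)"

definition mindices :: "nat \<Rightarrow> (nat ^ 'm) set" where
  "mindices k = {\<alpha>. mdeg \<alpha> \<le> k}"

definition monom_val :: "real ^ 'm \<Rightarrow> nat ^ 'm \<Rightarrow> real" where
  "monom_val x \<alpha> = (\<Prod>i\<in>UNIV. (x $ i) ^ (\<alpha> $ i))"

definition mpoly_eval :: "'m::finite mpoly \<Rightarrow> real ^ 'm \<Rightarrow> real" where
  "mpoly_eval p x = (\<Sum>\<alpha>\<in>Poly_Mapping.keys p. Poly_Mapping.lookup p \<alpha> * monom_val x \<alpha>)"

text \<open>Total degree; the zero polynomial gets degree 0.\<close>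

definition mpoly_deg :: "'m::finite mpoly \<Rightarrow> nat" where
  "mpoly_deg p = Max (insert 0 (mdeg ` Poly_Mapping.keys p))"

definition half_deg :: "'m::finite mpoly \<Rightarrow> nat" where
  "half_deg p = nat \<lceil>real (mpoly_deg p) / 2\<rceil>"

definition mpoly_const :: "real \<Rightarrow> 'm::finite mpoly" where
  "mpoly_const c = Poly_Mapping.single 0 c"

definition mpoly_monom :: "nat ^ 'm \<Rightarrow> 'm::finite mpoly" where
  "mpoly_monom \<alpha> = Poly_Mapping.single \<alpha> 1"

definition mpoly_var :: "'m \<Rightarrow> 'm::finite mpoly" where
  "mpoly_var i = mpoly_monom (axis i 1)"

text \<open>The constraint polynomials \<open>(g\<^sub>1, ..., g\<^sub>n) = (x\<^sub>1, ..., x\<^sub>n\<^sub>-\<^sub>1, 1 - x\<^sub>1 - ... - x\<^sub>n\<^sub>-\<^sub>1)\<close>.\<close>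

definition g_poly :: "'m option \<Rightarrow> 'm::finite mpoly" where
  "g_poly j = (case j of Some i \<Rightarrow> mpoly_var i | None \<Rightarrow> 1 - (\<Sum>i\<in>UNIV. mpoly_var i))"

section \<open>The sample average polynomial\<close>

text \<open>\<open>F x \<xi>\<close>, where \<open>\<mu>\<close> stands for the mean of the random vector.\<close>

definition F_fun ::
  "nat \<Rightarrow> (nat \<Rightarrow> real) \<Rightarrow> real ^ 'n \<Rightarrow> real ^ 'n \<Rightarrow> real ^ 'n \<Rightarrow> real" where
  "F_fun d lam \<mu> x \<xi> =
     - lam 1 * inner x \<xi> + (\<Sum>i=2..d. (-1) ^ i * lam i * (inner x \<xi> - inner x \<mu>) ^ i)"

text \<open>The vector \<open>(x, 1 - x\<^sub>1 - ... - x\<^sub>n\<^sub>-\<^sub>1)\<close>.\<close>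

definition complete_vec :: "real ^ 'm \<Rightarrow> real ^ ('m option)" where
  "complete_vec x = (\<chi> j. case j of Some i \<Rightarrow> x $ i | None \<Rightarrow> 1 - (\<Sum>i\<in>UNIV. x $ i))"

text \<open>The polynomial whose value at \<open>x\<close> is the inner product of \<open>complete_vec x\<close> and \<open>c\<close>.\<close>

definition lin_poly :: "real ^ ('m option) \<Rightarrow> 'm::finite mpoly" where
  "lin_poly c = (\<Sum>j\<in>UNIV. g_poly j * mpoly_const (c $ j))"

text \<open>
  The polynomial \<open>f\<^sub>N\<close>. As \<open>f\<^sub>N\<close> has a degree it is an element of the polynomial ring and not
  a function; lemma \<open>mpoly_eval_sample_avg_poly\<close> below shows that its values are the
  sample averages of \<open>F\<close>.
\<close>

definition sample_avg_poly ::
  "nat \<Rightarrow> (nat \<Rightarrow> real) \<Rightarrow> real ^ ('m option) \<Rightarrow> nat \<Rightarrow> (nat \<Rightarrow> real ^ ('m option))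
    \<Rightarrow> 'm::finite mpoly" where
  "sample_avg_poly d lam \<mu> N \<xi> =
     mpoly_const (1 / real N) *
       (\<Sum>k=1..N. - mpoly_const (lam 1) * lin_poly (\<xi> k)
          + (\<Sum>i=2..d. mpoly_const ((-1) ^ i * lam i) * (lin_poly (\<xi> k) - lin_poly \<mu>) ^ i))"

section \<open>Truncated multi-sequences and localizing matrices\<close>

text \<open>
  The space of real vectors indexed by \<open>mindices k\<close>: functions that are \<open>undefined\<close> outside
  \<open>mindices k\<close>, so that equality is equality of the entries on \<open>mindices k\<close>.
\<close>

definition tms :: "nat \<Rightarrow> (nat ^ 'm \<Rightarrow> real) set" where
  "tms k = extensional (mindices k)"

definition tms_pair :: "'m::finite mpoly \<Rightarrow> (nat ^ 'm \<Rightarrow> real) \<Rightarrow> real" where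
  "tms_pair p y = (\<Sum>\<alpha>\<in>Poly_Mapping.keys p. Poly_Mapping.lookup p \<alpha> * y \<alpha>)"

text \<open>
  Matrices indexed by a finite set \<open>I\<close> are represented by matrices of dimension \<open>card I\<close>, via the
  enumeration \<open>from_nat_into I\<close> of \<open>I\<close>. Definiteness and rank do not depend on the enumeration.
\<close>

definition indexed_mat :: "'i set \<Rightarrow> ('i \<Rightarrow> 'i \<Rightarrow> real) \<Rightarrow> real Matrix.mat" where
  "indexed_mat I A =
     Matrix.mat (card I) (card I) (\<lambda>(i, j). A (from_nat_into I i) (from_nat_into I j))"

definition coeff_vec :: "nat \<Rightarrow> 'm::finite mpoly \<Rightarrow> real Matrix.vec" where
  "coeff_vec k a =
     Matrix.vec (card (mindices k :: (nat ^ 'm) set))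
       (\<lambda>i. Poly_Mapping.lookup a (from_nat_into (mindices k) i))"

text \<open>
  The entries are forced by the defining identity \<open>vec(a)\<^sup>T L vec(b) = \<langle>q a b, y\<rangle>\<close>
  (take \<open>a\<close> and \<open>b\<close> to be monomials); the identity itself is lemma \<open>localizing_mat_bilinear\<close> below.
\<close>

definition localizing_mat ::
  "nat \<Rightarrow> 'm::finite mpoly \<Rightarrow> (nat ^ 'm \<Rightarrow> real) \<Rightarrow> real Matrix.mat" where
  "localizing_mat d0 q y =
     indexed_mat (mindices (d0 - half_deg q))
       (\<lambda>\<alpha> \<beta>. tms_pair (q * mpoly_monom \<alpha> * mpoly_monom \<beta>) y)"

definition moment_mat :: "nat \<Rightarrow> (nat ^ 'm::finite \<Rightarrow> real) \<Rightarrow> real Matrix.mat" where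
  "moment_mat d0 y = localizing_mat d0 1 y"

definition psd :: "real Matrix.mat \<Rightarrow> bool" where
  "psd A \<longleftrightarrow> square_mat A \<and> transpose_mat A = A \<and>
     (\<forall>v \<in> carrier_vec (dim_row A). Matrix.scalar_prod v (A *\<^sub>v v) \<ge> 0)"

definition mat_rank :: "real Matrix.mat \<Rightarrow> nat" where
  "mat_rank A = vec_space.rank (dim_row A) A"

section \<open>The two optimization problems\<close>

text \<open>\<open>L2_set y I\<close> is the Euclidean norm of the vector \<open>y\<close> with index set \<open>I\<close>.\<close>

definition feas_P :: "(real ^ 'm) set" where
  "feas_P = {x. (\<forall>i. x $ i \<ge> 0) \<and> 1 - (\<Sum>i\<in>UNIV. x $ i) \<ge> 0}"

definition obj_P :: "'m::finite mpoly \<Rightarrow> nat \<Rightarrow> real \<Rightarrow> real ^ 'm \<Rightarrow> real" where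
  "obj_P f d0 \<epsilon> x = mpoly_eval f x + \<epsilon> * L2_set (monom_val x) (mindices (2 * d0))"

definition feas_R :: "nat \<Rightarrow> (nat ^ 'm::finite \<Rightarrow> real) set" where
  "feas_R d0 = {y \<in> tms (2 * d0). y 0 = 1 \<and> psd (moment_mat d0 y) \<and>
     (\<forall>j. psd (localizing_mat d0 (g_poly j) y))}"

definition obj_R :: "'m::finite mpoly \<Rightarrow> nat \<Rightarrow> real \<Rightarrow> (nat ^ 'm \<Rightarrow> real) \<Rightarrow> real" where
  "obj_R f d0 \<epsilon> y = tms_pair f y + \<epsilon> * L2_set y (mindices (2 * d0))"

definition opt_val :: "('a \<Rightarrow> real) \<Rightarrow> 'a set \<Rightarrow> ereal" where
  "opt_val h S = (INF z\<in>S. ereal (h z))"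

section \<open>Agreement with the defining identities\<close>

lemma mpoly_sum_monoms:
  "(p :: 'm::finite mpoly) =
     (\<Sum>\<alpha>\<in>Poly_Mapping.keys p. Poly_Mapping.single \<alpha> (Poly_Mapping.lookup p \<alpha>))"
proof (rule poly_mapping_eqI)
  fix \<beta>
  show "Poly_Mapping.lookup p \<beta> = Poly_Mapping.lookup
    (\<Sum>\<alpha>\<in>Poly_Mapping.keys p. Poly_Mapping.single \<alpha> (Poly_Mapping.lookup p \<alpha>)) \<beta>"
    by (simp add: lookup_sum lookup_single when_def in_keys_iff)
qed

lemma tms_pair_superset:
  assumes "finite S" "Poly_Mapping.keys p \<subseteq> S"
  shows "tms_pair p y = (\<Sum>\<alpha>\<in>S. Poly_Mapping.lookup p \<alpha> * y \<alpha>)"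
  unfolding tms_pair_def
  by (rule sum.mono_neutral_left) (use assms in \<open>auto simp: in_keys_iff\<close>)

lemma tms_pair_add: "tms_pair (p + q) y = tms_pair p y + tms_pair q y"
proof -
  let ?S = "Poly_Mapping.keys p \<union> Poly_Mapping.keys q"
  have "tms_pair (p + q) y = (\<Sum>\<alpha>\<in>?S. Poly_Mapping.lookup (p + q) \<alpha> * y \<alpha>)"
    by (rule tms_pair_superset) (simp_all add: Poly_Mapping.keys_add)
  also have "\<dots> = (\<Sum>\<alpha>\<in>?S. Poly_Mapping.lookup p \<alpha> * y \<alpha>)
                + (\<Sum>\<alpha>\<in>?S. Poly_Mapping.lookup q \<alpha> * y \<alpha>)"
    by (simp add: lookup_add algebra_simps sum.distrib)
  also have "\<dots> = tms_pair p y + tms_pair q y"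
    by (simp add: tms_pair_superset[of ?S])
  finally show ?thesis .
qed

lemma tms_pair_zero [simp]: "tms_pair 0 y = 0"
  by (simp add: tms_pair_def)

lemma tms_pair_sum: "tms_pair (\<Sum>i\<in>I. p i) y = (\<Sum>i\<in>I. tms_pair (p i) y)"
  by (induction I rule: infinite_finite_induct) (simp_all add: tms_pair_add)

lemma tms_pair_single: "tms_pair (Poly_Mapping.single \<alpha> c) y = c * y \<alpha>"
  by (simp add: tms_pair_def)

lemma tms_pair_const_mult: "tms_pair (mpoly_const c * p) y = c * tms_pair p y"
proof -
  have "mpoly_const c * p =
    (\<Sum>\<alpha>\<in>Poly_Mapping.keys p. Poly_Mapping.single \<alpha> (c * Poly_Mapping.lookup p \<alpha>))"
    by (subst mpoly_sum_monoms[of p])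
       (simp add: mpoly_const_def sum_distrib_left mult_single)
  then show ?thesis
    by (simp add: tms_pair_sum tms_pair_single) (simp add: tms_pair_def sum_distrib_left mult.assoc)
qed

lemma mpoly_eval_tms_pair: "mpoly_eval p x = tms_pair p (monom_val x)"
  by (simp add: mpoly_eval_def tms_pair_def)

lemma monom_val_add: "monom_val x (\<alpha> + \<beta>) = monom_val x \<alpha> * monom_val x \<beta>"
  by (simp add: monom_val_def power_add prod.distrib)

lemma monom_val_zero [simp]: "monom_val x 0 = 1"
  by (simp add: monom_val_def)

lemma monom_val_axis: "monom_val x (axis i 1) = x $ i"
proof -
  have "monom_val x (axis i 1) = (\<Prod>j\<in>UNIV. if j = i then x $ i else 1)"
    unfolding monom_val_def by (rule prod.cong) (auto simp: axis_def)
  then show ?thesis by simp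
qed

lemma mpoly_eval_mult: "mpoly_eval (p * q) x = mpoly_eval p x * mpoly_eval q x"
proof -
  have "p * q = (\<Sum>\<alpha>\<in>Poly_Mapping.keys p. \<Sum>\<beta>\<in>Poly_Mapping.keys q.
      Poly_Mapping.single (\<alpha> + \<beta>) (Poly_Mapping.lookup p \<alpha> * Poly_Mapping.lookup q \<beta>))"
    by (subst mpoly_sum_monoms[of p], subst mpoly_sum_monoms[of q])
       (simp add: sum_product mult_single)
  then show ?thesis
    by (simp add: mpoly_eval_tms_pair tms_pair_sum tms_pair_single monom_val_add)
       (simp add: tms_pair_def sum_product algebra_simps)
qed

lemma mpoly_eval_const [simp]: "mpoly_eval (mpoly_const c) x = c"
  by (simp add: mpoly_eval_tms_pair mpoly_const_def tms_pair_single)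

lemma mpoly_eval_one [simp]: "mpoly_eval 1 x = 1"
  using mpoly_eval_const[of 1 x] by (simp add: mpoly_const_def)

lemma mpoly_eval_var [simp]: "mpoly_eval (mpoly_var i) x = x $ i"
  using monom_val_axis[of x i]
  by (simp add: mpoly_eval_tms_pair mpoly_var_def mpoly_monom_def tms_pair_single)

lemma mpoly_eval_add: "mpoly_eval (p + q) x = mpoly_eval p x + mpoly_eval q x"
  by (simp add: mpoly_eval_tms_pair tms_pair_add)

lemma mpoly_eval_sum: "mpoly_eval (\<Sum>i\<in>I. p i) x = (\<Sum>i\<in>I. mpoly_eval (p i) x)"
  by (simp add: mpoly_eval_tms_pair tms_pair_sum)

lemma mpoly_eval_diff: "mpoly_eval (p - q) x = mpoly_eval p x - mpoly_eval q x"
  using mpoly_eval_add[of "p - q" q x] by simp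

lemma mpoly_eval_minus: "mpoly_eval (- p) x = - mpoly_eval p x"
  using mpoly_eval_diff[of 0 p x] by (simp add: mpoly_eval_tms_pair)

lemma mpoly_eval_power: "mpoly_eval (p ^ k) x = mpoly_eval p x ^ k"
  by (induction k) (simp_all add: mpoly_eval_mult)

lemma mpoly_eval_g_poly: "mpoly_eval (g_poly j) x = complete_vec x $ j"
  by (cases j) (simp_all add: g_poly_def complete_vec_def mpoly_eval_diff mpoly_eval_sum)

lemma mpoly_eval_lin_poly: "mpoly_eval (lin_poly c) x = inner (complete_vec x) c"
  by (simp add: lin_poly_def mpoly_eval_sum mpoly_eval_mult mpoly_eval_g_poly inner_vec_def)

lemma mpoly_eval_sample_avg_poly:
  "mpoly_eval (sample_avg_poly d lam \<mu> N \<xi>) x =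
     1 / real N * (\<Sum>k=1..N. F_fun d lam \<mu> (complete_vec x) (\<xi> k))"
  unfolding sample_avg_poly_def F_fun_def
  by (simp add: mpoly_eval_mult mpoly_eval_sum mpoly_eval_add mpoly_eval_minus
      mpoly_eval_power mpoly_eval_diff mpoly_eval_lin_poly)

lemma finite_mindices: "finite (mindices k :: (nat ^ 'm) set)"
proof -
  have "(mindices k :: (nat ^ 'm) set) \<subseteq> vec_lambda ` (UNIV \<rightarrow>\<^sub>E {..k})"
  proof
    fix \<alpha> :: "nat ^ 'm"
    assume "\<alpha> \<in> mindices k"
    then have "(\<Sum>i\<in>UNIV. \<alpha> $ i) \<le> k"
      by (simp add: mindices_def mdeg_def)
    moreover have "\<alpha> $ i \<le> (\<Sum>i\<in>UNIV. \<alpha> $ i)" for i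
      by (rule member_le_sum) auto
    ultimately have "vec_nth \<alpha> \<in> UNIV \<rightarrow>\<^sub>E {..k}"
      by (auto intro: order_trans)
    then show "\<alpha> \<in> vec_lambda ` (UNIV \<rightarrow>\<^sub>E {..k})"
      by (metis image_eqI vec_nth_inverse)
  qed
  then show ?thesis
    by (rule finite_subset) (simp add: finite_PiE)
qed

lemma sum_from_nat_into:
  assumes "finite I"
  shows "(\<Sum>i = 0..<card I. h (from_nat_into I i)) = sum h I"
  using sum.reindex_bij_betw[OF bij_betw_from_nat_into_finite[OF assms], of h]
  by (simp add: atLeast0LessThan)

lemma keys_subset_mindices:
  assumes "mpoly_deg p \<le> k"
  shows "Poly_Mapping.keys p \<subseteq> mindices k"
  using assms by (auto simp: mpoly_deg_def mindices_def)

lemma localizing_mat_bilinear: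
  fixes a b q :: "'m::finite mpoly" and d0 :: nat
  defines "k \<equiv> d0 - half_deg q"
  assumes a: "mpoly_deg a \<le> k" and b: "mpoly_deg b \<le> k"
  shows "Matrix.scalar_prod (coeff_vec k a) (localizing_mat d0 q y *\<^sub>v coeff_vec k b)
    = tms_pair (q * a * b) y"
proof -
  let ?I = "mindices k :: (nat ^ 'm) set"
  let ?e = "from_nat_into ?I"
  let ?L = "\<lambda>\<alpha> \<beta>. tms_pair (q * mpoly_monom \<alpha> * mpoly_monom \<beta>) y"
  have rep: "p = (\<Sum>\<alpha>\<in>?I. mpoly_const (Poly_Mapping.lookup p \<alpha>) * mpoly_monom \<alpha>)"
    if "mpoly_deg p \<le> k" for p :: "'m mpoly"
    by (subst mpoly_sum_monoms[of p], rule sum.mono_neutral_cong_left)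
       (use keys_subset_mindices[OF that] in
          \<open>auto simp: finite_mindices mpoly_const_def mpoly_monom_def mult_single in_keys_iff\<close>)
  have "Matrix.scalar_prod (coeff_vec k a) (localizing_mat d0 q y *\<^sub>v coeff_vec k b)
    = (\<Sum>i = 0..<card ?I. Poly_Mapping.lookup a (?e i) *
        (\<Sum>j = 0..<card ?I. ?L (?e i) (?e j) * Poly_Mapping.lookup b (?e j)))"
    unfolding localizing_mat_def k_def[symmetric]
    by (simp add: Matrix.scalar_prod_def coeff_vec_def indexed_mat_def)
  also have "\<dots> = (\<Sum>\<alpha>\<in>?I. Poly_Mapping.lookup a \<alpha> *
        (\<Sum>\<beta>\<in>?I. ?L \<alpha> \<beta> * Poly_Mapping.lookup b \<beta>))"
    by (simp add: sum_from_nat_into[OF finite_mindices,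
          where h = "\<lambda>\<beta>. ?L _ \<beta> * Poly_Mapping.lookup b \<beta>"]
        sum_from_nat_into[OF finite_mindices,
          where h = "\<lambda>\<alpha>. Poly_Mapping.lookup a \<alpha> * (\<Sum>\<beta>\<in>?I. ?L \<alpha> \<beta> * Poly_Mapping.lookup b \<beta>)"])
  also have "\<dots> = (\<Sum>\<alpha>\<in>?I. \<Sum>\<beta>\<in>?I.
      tms_pair (mpoly_const (Poly_Mapping.lookup a \<alpha> * Poly_Mapping.lookup b \<beta>) *
        (q * mpoly_monom \<alpha> * mpoly_monom \<beta>)) y)"
    by (simp only: tms_pair_const_mult) (simp add: sum_distrib_left mult_ac)
  also have "\<dots> = tms_pair (\<Sum>\<alpha>\<in>?I. \<Sum>\<beta>\<in>?I.
      mpoly_const (Poly_Mapping.lookup a \<alpha> * Poly_Mapping.lookup b \<beta>) *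
        (q * mpoly_monom \<alpha> * mpoly_monom \<beta>)) y"
    by (simp add: tms_pair_sum)
  also have "(\<Sum>\<alpha>\<in>?I. \<Sum>\<beta>\<in>?I.
      mpoly_const (Poly_Mapping.lookup a \<alpha> * Poly_Mapping.lookup b \<beta>) *
        (q * mpoly_monom \<alpha> * mpoly_monom \<beta>))
    = q * (\<Sum>\<alpha>\<in>?I. mpoly_const (Poly_Mapping.lookup a \<alpha>) * mpoly_monom \<alpha>)
        * (\<Sum>\<beta>\<in>?I. mpoly_const (Poly_Mapping.lookup b \<beta>) * mpoly_monom \<beta>)"
  proof -
    have c: "mpoly_const (r * s) = mpoly_const r * (mpoly_const s :: 'm mpoly)" for r s
      by (simp add: mpoly_const_def mult_single)
    show ?thesis
      by (simp add: c sum_distrib_left sum_distrib_right mult_ac)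
  qed
  also have "\<dots> = q * a * b"
    using rep[OF a] rep[OF b] by simp
  finally show ?thesis .
qed

lemma localizing_mat_sym: "transpose_mat (localizing_mat d0 q y) = localizing_mat d0 q y"
  by (rule eq_matI) (simp_all add: localizing_mat_def indexed_mat_def mult_ac)

lemma moment_mat_eq: "moment_mat d0 y = indexed_mat (mindices d0) (\<lambda>\<alpha> \<beta>. y (\<alpha> + \<beta>))"
  by (simp add: moment_mat_def localizing_mat_def half_deg_def mpoly_deg_def mdeg_def
      mpoly_monom_def mult_single tms_pair_single)

end

theory Submission
  imports Defs
begin

text \<open>
  Restricting \<open>x \<mapsto> monom_val x\<close> to the simplex embeds \<open>(P)\<close> into \<open>(R)\<close>, so \<open>(R)\<close> is a lower bound.
  Since \<open>y\<^sub>0 = 1\<close>, rank one of the moment matrix means \<open>y\<^sub>\<alpha>\<^sub>+\<^sub>\<beta> = y\<^sub>\<alpha> y\<^sub>\<beta>\<close>, so \<open>y\<close> is the moment sequence of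
  a point; that point lies in the simplex because of the (0,0) entries of the localizing matrices.
  Conversely, under tightness the moment sequence of a minimizer of \<open>(P)\<close>, which exists by
  compactness, is a minimizer of \<open>(R)\<close>. The Euclidean norm is strictly convex on the affine
  hyperplane \<open>y\<^sub>0 = 1\<close>, so \<open>(R)\<close> has only one minimizer, and it has a rank-one moment matrix.
\<close>

section \<open>Rank-one matrices\<close>

text \<open>A column with a nonzero entry is linearly independent on its own.\<close>

lemma (in vec_space) rank_ge_1_if_entry_nonzero:
  assumes A: "A \<in> carrier_mat n nc" and ij: "i < n" "j < nc" "A $$ (i, j) \<noteq> 0"
  shows "rank A \<ge> 1"
proof -
  let ?c = "col A j"
  have c: "?c \<in> carrier_vec n" "?c \<in> set (cols A)"
    using A ij by (auto simp: cols_def)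
  have "lin_indpt {?c}"
  proof
    assume "lin_dep {?c}"
    then obtain a w where "lincomb a {?c} = 0\<^sub>v n" "w \<in> {?c}" "a w \<noteq> 0"
      using finite_lin_dep[of "{?c}"] c(1) by auto
    moreover have "vec_index (lincomb a {?c}) i = a ?c * A $$ (i, j)"
      using c A ij by (subst lincomb_index) auto
    ultimately show False using ij by auto
  qed
  then show ?thesis
    using rank_ge_card_indpt[OF A, of "{?c}"] c by simp
qed

text \<open>Rank at most 1 forces a nontrivial linear relation between any two distinct columns, and
  such a relation makes their 2x2 minors vanish.\<close>

lemma (in vec_space) rank_le_1_minor_zero:
  assumes A: "A \<in> carrier_mat n nc" and r: "rank A \<le> 1"
    and ik: "i < n" "k < n" and jl: "j < nc" "l < nc"
  shows "A $$ (i, j) * A $$ (k, l) = A $$ (i, l) * A $$ (k, j)"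
\<comment> \<open>Dependence is stated for sets of columns, and equal columns would collapse to a
  singleton, so they are treated apart.\<close>
proof (cases "col A j = col A l")
  case True
  then have "A $$ (i, j) = A $$ (i, l)" "A $$ (k, j) = A $$ (k, l)"
    using A ik jl by (metis carrier_matD index_col)+
  then show ?thesis by simp
next
  case False
  let ?S = "{col A j, col A l}"
  have S: "?S \<subseteq> carrier_vec n" "?S \<subseteq> set (cols A)"
    using A jl by (auto simp: cols_def)
  have "lin_dep ?S"
    using rank_ge_card_indpt[OF A S(2)] r False by auto
  then obtain a w where w: "lincomb a ?S = 0\<^sub>v n" "w \<in> ?S" "a w \<noteq> 0"
    using finite_lin_dep[of ?S] S(1) by auto
  have e: "a (col A j) * A $$ (s, j) + a (col A l) * A $$ (s, l) = 0" if "s < n" for s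
  proof -
    have "vec_index (lincomb a ?S) s = a (col A j) * A $$ (s, j) + a (col A l) * A $$ (s, l)"
      using S A that jl False by (subst lincomb_index) auto
    then show ?thesis using w(1) that by simp
  qed
  let ?a = "a (col A j)" and ?b = "a (col A l)"
  let ?D = "A $$ (i, j) * A $$ (k, l) - A $$ (i, l) * A $$ (k, j)"
  \<comment> \<open>Combining the relation in rows \<open>i\<close> and \<open>k\<close> shows that
    both coefficients annihilate the minor \<open>?D\<close>; at least one coefficient is
    nonzero.\<close>
  have "?a * ?D = (?a * A $$ (i, j) + ?b * A $$ (i, l)) * A $$ (k, l)
      - (?a * A $$ (k, j) + ?b * A $$ (k, l)) * A $$ (i, l)"
    by (simp add: algebra_simps)
  moreover have "?b * ?D = (?a * A $$ (k, j) + ?b * A $$ (k, l)) * A $$ (i, j)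
      - (?a * A $$ (i, j) + ?b * A $$ (i, l)) * A $$ (k, j)"
    by (simp add: algebra_simps)
  ultimately have "?a * ?D = 0" "?b * ?D = 0"
    using e ik by auto
  then have "?D = 0"
    using w by auto
  then show ?thesis by simp
qed

section \<open>Rank and semidefiniteness in terms of the index set\<close>

lemma indexed_mat_carrier: "indexed_mat I A \<in> carrier_mat (card I) (card I)"
  by (simp add: indexed_mat_def)

lemma from_nat_into_cases:
  assumes "finite I" "\<alpha> \<in> I"
  obtains i where "i < card I" "from_nat_into I i = \<alpha>"
  using bij_betw_from_nat_into_finite[OF assms(1)] assms(2)
  unfolding bij_betw_def by (metis imageE lessThan_iff)

text \<open>The entry \<open>A \<zeta> \<zeta>\<close> serves as a pivot. It excludes rank 0, and
  vanishing of the 2x2 minors through it says that the matrix is the outer product of the pivot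
  column and the pivot row, divided by the pivot.\<close>

lemma mat_rank_indexed_mat_eq_1_iff:
  assumes I: "finite I" and z: "\<zeta> \<in> I" "A \<zeta> \<zeta> \<noteq> 0"
  shows "mat_rank (indexed_mat I A) = 1 \<longleftrightarrow>
    (\<forall>\<alpha>\<in>I. \<forall>\<beta>\<in>I. A \<zeta> \<zeta> * A \<alpha> \<beta> = A \<alpha> \<zeta> * A \<zeta> \<beta>)"
    (is "?L \<longleftrightarrow> ?R")
proof
  interpret V: vec_space "TYPE(real)" "card I" .
  have d: "dim_row (indexed_mat I A) = card I" by (simp add: indexed_mat_def)
  obtain z0 where z0: "z0 < card I" "from_nat_into I z0 = \<zeta>"
    using from_nat_into_cases[OF I z(1)] .
  {
    assume L: ?L
    show ?R
    proof (intro ballI)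
      fix \<alpha> \<beta> assume "\<alpha> \<in> I" "\<beta> \<in> I"
      obtain a where a: "a < card I" "from_nat_into I a = \<alpha>"
        using from_nat_into_cases[OF I \<open>\<alpha> \<in> I\<close>] .
      obtain b where b: "b < card I" "from_nat_into I b = \<beta>"
        using from_nat_into_cases[OF I \<open>\<beta> \<in> I\<close>] .
      show "A \<zeta> \<zeta> * A \<alpha> \<beta> = A \<alpha> \<zeta> * A \<zeta> \<beta>"
        using V.rank_le_1_minor_zero[OF indexed_mat_carrier[of I A], of z0 a z0 b] L a b z0
        by (simp add: mat_rank_def d) (simp add: indexed_mat_def mult.commute)
    qed
  next
    assume R: ?R
    have "V.rank (indexed_mat I A) \<le> 1"
    proof (rule V.rank_le_1_product_entries[OF indexed_mat_carrier])
      fix r c assume "r < dim_row (indexed_mat I A)" "c < dim_col (indexed_mat I A)"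
      then have rc: "r < card I" "c < card I" by (simp_all add: indexed_mat_def)
      \<comment> \<open>\<open>from_nat_into\<close> is sure to land in \<open>I\<close> only when
        \<open>I\<close> is nonempty, which follows from \<open>r < card I\<close>.\<close>
      then have "from_nat_into I r \<in> I" "from_nat_into I c \<in> I"
        by (metis card.empty from_nat_into not_less_zero)+
      then have "A (from_nat_into I r) (from_nat_into I c) =
         A (from_nat_into I r) \<zeta> * (A \<zeta> (from_nat_into I c) / A \<zeta> \<zeta>)"
        using R[rule_format, of "from_nat_into I r" "from_nat_into I c"] z by (simp add: field_simps)
      then show "indexed_mat I A $$ (r, c) =
         A (from_nat_into I r) \<zeta> * (A \<zeta> (from_nat_into I c) / A \<zeta> \<zeta>)"
        using rc by (simp add: indexed_mat_def)
    qed
    moreover have "V.rank (indexed_mat I A) \<ge> 1"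
      by (rule V.rank_ge_1_if_entry_nonzero[OF indexed_mat_carrier z0(1) z0(1)])
         (use z z0 in \<open>simp add: indexed_mat_def\<close>)
    ultimately show ?L
      by (simp add: mat_rank_def d)
  }
qed

text \<open>Replaces vectors numbered below \<open>card I\<close> by functions on \<open>I\<close>,
  so that later arguments never meet the enumeration.\<close>

lemma psd_indexed_mat_iff:
  assumes I: "finite I" and sym: "\<And>\<alpha> \<beta>. A \<alpha> \<beta> = A \<beta> \<alpha>"
  shows "psd (indexed_mat I A) \<longleftrightarrow> (\<forall>v. 0 \<le> (\<Sum>\<alpha>\<in>I. \<Sum>\<beta>\<in>I. v \<alpha> * A \<alpha> \<beta> * v \<beta>))"
proof -
  let ?e = "from_nat_into I" and ?B = "indexed_mat I A"
  have quad: "Matrix.scalar_prod w (?B *\<^sub>v w) = (\<Sum>\<alpha>\<in>I. \<Sum>\<beta>\<in>I. v \<alpha> * A \<alpha> \<beta> * v \<beta>)"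
    if w: "w = Matrix.vec (card I) (\<lambda>i. v (?e i))" for v w
  proof -
    have "Matrix.scalar_prod w (?B *\<^sub>v w) =
        (\<Sum>i = 0..<card I. \<Sum>j = 0..<card I. v (?e i) * A (?e i) (?e j) * v (?e j))"
      by (simp add: w indexed_mat_def Matrix.scalar_prod_def sum_distrib_left mult.assoc)
    also have "\<dots> = (\<Sum>i = 0..<card I. \<Sum>\<beta>\<in>I. v (?e i) * A (?e i) \<beta> * v \<beta>)"
      by (intro sum.cong refl) (rule sum_from_nat_into[OF I])
    also have "\<dots> = (\<Sum>\<alpha>\<in>I. \<Sum>\<beta>\<in>I. v \<alpha> * A \<alpha> \<beta> * v \<beta>)"
      by (rule sum_from_nat_into[OF I])
    finally show ?thesis .
  qed
  have repr: "\<exists>v. w = Matrix.vec (card I) (\<lambda>i. v (?e i))" if "w \<in> carrier_vec (card I)" for w :: "real Matrix.vec"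
  \<comment> \<open>The witness is \<open>w\<close> composed with the inverse of the enumeration,
    which is injective below \<open>card I\<close>.\<close>
  proof (intro exI eq_vecI)
    have inj: "inj_on ?e {..<card I}"
      using bij_betw_from_nat_into_finite[OF I] by (simp add: bij_betw_def)
    fix i assume i: "i < dim_vec (Matrix.vec (card I)
      (\<lambda>i. vec_index w (inv_into {..<card I} ?e (?e i))))"
    then show "vec_index w i = vec_index (Matrix.vec (card I)
      (\<lambda>i. vec_index w (inv_into {..<card I} ?e (?e i)))) i"
      using inv_into_f_f[OF inj, of i] by simp
  qed (use that in auto)
  have 1: "square_mat ?B" "transpose_mat ?B = ?B" "dim_row ?B = card I"
    using sym by (auto simp: indexed_mat_def intro!: eq_matI)
  show ?thesis
  proof
    assume p: "psd ?B"
    show "\<forall>v. 0 \<le> (\<Sum>\<alpha>\<in>I. \<Sum>\<beta>\<in>I. v \<alpha> * A \<alpha> \<beta> * v \<beta>)"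
    proof
      fix v
      show "0 \<le> (\<Sum>\<alpha>\<in>I. \<Sum>\<beta>\<in>I. v \<alpha> * A \<alpha> \<beta> * v \<beta>)"
        using p unfolding psd_def 1 quad[OF refl, symmetric] by simp
    qed
  next
    assume "\<forall>v. 0 \<le> (\<Sum>\<alpha>\<in>I. \<Sum>\<beta>\<in>I. v \<alpha> * A \<alpha> \<beta> * v \<beta>)"
    then show "psd ?B"
      unfolding psd_def 1(3) using 1(1,2) repr quad by metis
  qed
qed

section \<open>Multi-indices\<close>

lemma mdeg_add: "mdeg (\<alpha> + \<beta>) = mdeg \<alpha> + mdeg \<beta>"
  by (simp add: mdeg_def sum.distrib)

lemma mdeg_zero [simp]: "mdeg 0 = 0"
  by (simp add: mdeg_def)

lemma mdeg_axis [simp]: "mdeg (axis i (Suc 0)) = 1"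
  by (simp add: mdeg_def axis_def)

lemma mdeg_eq_0_iff: "mdeg \<alpha> = 0 \<longleftrightarrow> \<alpha> = 0"
  by (simp add: mdeg_def Finite_Cartesian_Product.vec_eq_iff)

lemma multi_index_nonzeroE:
  fixes \<alpha> :: "nat ^ 'm"
  assumes "\<alpha> \<noteq> 0"
  obtains i \<gamma> where "\<alpha> = axis i 1 + \<gamma>"
proof -
  obtain i where i: "\<alpha> $ i \<noteq> 0"
    using assms by (auto simp: Finite_Cartesian_Product.vec_eq_iff)
  have "\<alpha> = axis i 1 + (\<chi> j. if j = i then \<alpha> $ i - 1 else \<alpha> $ j)"
    using i by (auto simp: Finite_Cartesian_Product.vec_eq_iff axis_def)
  then show thesis by (rule that)
qed

text \<open>Serves to halve an index of degree at most \<open>2 * k\<close> into two indices of the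
  moment matrix. Unit vectors are moved one by one from the rest \<open>\<gamma>\<close> to
  \<open>\<beta>\<close>.\<close>

lemma multi_index_split:
  assumes "k \<le> mdeg \<alpha>"
  shows "\<exists>\<beta> \<gamma>. \<alpha> = \<beta> + \<gamma> \<and> mdeg \<beta> = k"
  using assms
proof (induction k)
  case 0
  show ?case by (rule exI[of _ 0]) simp
next
  case (Suc k)
  then obtain \<beta> \<gamma> where s: "\<alpha> = \<beta> + \<gamma>" "mdeg \<beta> = k" by auto
  with Suc.prems have "\<gamma> \<noteq> 0" by (auto simp: mdeg_add)
  then obtain i \<delta> where "\<gamma> = axis i 1 + \<delta>" by (rule multi_index_nonzeroE)
  with s have "\<alpha> = (\<beta> + axis i 1) + \<delta>" "mdeg (\<beta> + axis i 1) = Suc k"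
    by (simp_all add: add.assoc mdeg_add)
  then show ?case by blast
qed

lemma zero_mem_mindices [simp]: "0 \<in> mindices k"
  by (simp add: mindices_def)

text \<open>Up to degree \<open>k\<close>, unit vectors are peeled off by induction;
  \<open>k \<ge> 1\<close> makes them admissible factors. Since multiplicativity is given only for
  factors of degree at most \<open>k\<close>, higher degrees are reached by a single split.\<close>

lemma multiplicative_imp_monom_val:
  fixes y :: "nat ^ 'm::finite \<Rightarrow> real"
  assumes y0: "y 0 = 1" and k: "k \<ge> 1"
    and mult: "\<And>\<alpha> \<beta>. \<alpha> \<in> mindices k \<Longrightarrow> \<beta> \<in> mindices k \<Longrightarrow> y (\<alpha> + \<beta>) = y \<alpha> * y \<beta>"
    and "\<alpha> \<in> mindices (2 * k)"
  shows "y \<alpha> = monom_val (\<chi> i. y (axis i 1)) \<alpha>"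
proof -
  let ?u = "\<chi> i. y (axis i 1)"
  have low: "y \<alpha> = monom_val ?u \<alpha>" if "mdeg \<alpha> \<le> k" for \<alpha>
    using that
  proof (induction "mdeg \<alpha>" arbitrary: \<alpha>)
    case 0
    then show ?case using y0 by (metis mdeg_eq_0_iff monom_val_zero)
  next
    case (Suc l)
    then have "\<alpha> \<noteq> 0" by auto
    then obtain i \<gamma> where \<alpha>: "\<alpha> = axis i 1 + \<gamma>" by (rule multi_index_nonzeroE)
    then have "mdeg \<gamma> = l" using Suc by (simp add: mdeg_add)
    then have "y \<gamma> = monom_val ?u \<gamma>" using Suc by auto
    moreover have "y \<alpha> = y (axis i 1) * y \<gamma>"
      unfolding \<alpha> by (rule mult) (use k Suc \<open>mdeg \<gamma> = l\<close> in \<open>auto simp: mindices_def\<close>)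
    ultimately show ?case
      by (simp add: \<alpha> monom_val_add monom_val_axis[unfolded One_nat_def])
  qed
  \<comment> \<open>The minimum also covers indices of degree below \<open>k\<close>, for which
    \<open>\<gamma> = 0\<close>.\<close>
  obtain \<beta> \<gamma> where s: "\<alpha> = \<beta> + \<gamma>" "mdeg \<beta> = min k (mdeg \<alpha>)"
    using multi_index_split[of "min k (mdeg \<alpha>)" \<alpha>] by auto
  then have "mdeg \<beta> \<le> k" "mdeg \<gamma> \<le> k"
    using assms(4) by (auto simp: mindices_def mdeg_add)
  then show ?thesis
    using mult[of \<beta> \<gamma>] by (simp add: s(1) low monom_val_add mindices_def)
qed

section \<open>Localizing matrices\<close>

lemma mpoly_deg_le_iff: "mpoly_deg p \<le> k \<longleftrightarrow> Poly_Mapping.keys p \<subseteq> mindices k"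
  by (auto simp: mpoly_deg_def mindices_def)

lemma mpoly_deg_le_half_deg: "mpoly_deg p \<le> 2 * half_deg p"
  unfolding half_deg_def by linarith

lemma half_deg_le: "mpoly_deg p \<le> 2 * k \<Longrightarrow> half_deg p \<le> k"
  unfolding half_deg_def by linarith

lemma half_deg_one: "half_deg 1 = 0"
  by (simp add: half_deg_def mpoly_deg_def)

text \<open>For \<open>k \<ge> 1\<close> this keeps the natural-number subtraction
  \<open>k - half_deg (g_poly j)\<close> from being truncated.\<close>

lemma half_deg_g_poly_le: "half_deg (g_poly j) \<le> 1"
proof -
  have "Poly_Mapping.keys (g_poly j) \<subseteq> mindices 1"
  proof (cases j)
    case (Some i)
    then show ?thesis
      by (simp add: g_poly_def mpoly_var_def mpoly_monom_def mindices_def)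
  next
    case None
    show ?thesis
    proof
      fix \<alpha> assume "\<alpha> \<in> Poly_Mapping.keys (g_poly j)"
      then have *: "Poly_Mapping.lookup (g_poly j) \<alpha> \<noteq> 0"
        by (simp add: in_keys_iff)
      show "\<alpha> \<in> mindices 1"
      proof (rule ccontr)
        assume "\<alpha> \<notin> mindices 1"
        then have "\<alpha> \<noteq> 0" "axis i 1 \<noteq> \<alpha>" for i
          by (auto simp: mindices_def)
        then show False
          using * None by (auto simp: g_poly_def lookup_minus lookup_sum lookup_one mpoly_var_def
              mpoly_monom_def lookup_single when_def)
      qed
    qed
  qed
  then have "mpoly_deg (g_poly j) \<le> 1"
    by (simp only: mpoly_deg_le_iff)
  then show ?thesis
    by (intro half_deg_le) simp
qed

section \<open>The pairing and the semidefiniteness of localizing matrices\<close>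

lemma tms_pair_cong:
  "(\<And>\<alpha>. \<alpha> \<in> Poly_Mapping.keys p \<Longrightarrow> y \<alpha> = z \<alpha>) \<Longrightarrow> tms_pair p y = tms_pair p z"
  by (simp add: tms_pair_def)

lemma tms_pair_midpoint:
  "tms_pair p (\<lambda>\<alpha>. (y \<alpha> + z \<alpha>) / 2) = (tms_pair p y + tms_pair p z) / 2"
  by (simp add: tms_pair_def distrib_left add_divide_distrib sum.distrib sum_divide_distrib)

lemma tms_pair_mult_right: "tms_pair p (\<lambda>\<alpha>. y \<alpha> * c) = tms_pair p y * c"
  by (simp add: tms_pair_def sum_distrib_right mult.assoc)

text \<open>Multiplication by monomials becomes a shift of the sequence, so that every matrix entry
  is the same functional \<open>tms_pair q\<close> applied to a shifted \<open>y\<close>.\<close>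

lemma tms_pair_mult_monoms:
  "tms_pair (q * mpoly_monom \<alpha> * mpoly_monom \<beta>) y = tms_pair q (\<lambda>\<kappa>. y (\<kappa> + \<alpha> + \<beta>))"
proof -
  have "q * mpoly_monom \<alpha> * mpoly_monom \<beta> = (\<Sum>\<kappa>\<in>Poly_Mapping.keys q.
      Poly_Mapping.single (\<kappa> + \<alpha> + \<beta>) (Poly_Mapping.lookup q \<kappa>))"
    by (subst mpoly_sum_monoms[of q])
       (simp add: mpoly_monom_def sum_distrib_right mult_single)
  then show ?thesis
    by (simp add: tms_pair_sum tms_pair_single) (simp add: tms_pair_def)
qed

text \<open>For fixed \<open>v\<close> the quadratic form is linear in \<open>y\<close>; this is the
  source of convexity of the feasible set of \<open>(R)\<close>.\<close>

lemma psd_localizing_mat_iff: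
  "psd (localizing_mat k q y) \<longleftrightarrow>
    (\<forall>v. 0 \<le> (\<Sum>\<alpha>\<in>mindices (k - half_deg q). \<Sum>\<beta>\<in>mindices (k - half_deg q).
      v \<alpha> * tms_pair q (\<lambda>\<kappa>. y (\<kappa> + \<alpha> + \<beta>)) * v \<beta>))"
  unfolding localizing_mat_def tms_pair_mult_monoms
  by (rule psd_indexed_mat_iff[OF finite_mindices]) (simp add: add_ac)

text \<open>The entries read \<open>y\<close> only up to degree
  \<open>2 * half_deg q + 2 * (k - half_deg q) = 2 * k\<close>.\<close>

lemma psd_localizing_mat_cong:
  assumes q: "half_deg q \<le> k" and eq: "\<And>\<gamma>. \<gamma> \<in> mindices (2 * k) \<Longrightarrow> y \<gamma> = z \<gamma>"
  shows "psd (localizing_mat k q y) \<longleftrightarrow> psd (localizing_mat k q z)"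
proof -
  have "tms_pair q (\<lambda>\<kappa>. y (\<kappa> + \<alpha> + \<beta>)) = tms_pair q (\<lambda>\<kappa>. z (\<kappa> + \<alpha> + \<beta>))"
    if "\<alpha> \<in> mindices (k - half_deg q)" "\<beta> \<in> mindices (k - half_deg q)" for \<alpha> \<beta>
  proof (rule tms_pair_cong, rule eq)
    fix \<kappa> assume "\<kappa> \<in> Poly_Mapping.keys q"
    then have "mdeg \<kappa> \<le> 2 * half_deg q"
      using keys_subset_mindices[OF mpoly_deg_le_half_deg] by (auto simp: mindices_def)
    then show "\<kappa> + \<alpha> + \<beta> \<in> mindices (2 * k)"
      using that q by (simp add: mindices_def mdeg_add)
  qed
  then show ?thesis
    by (simp add: psd_localizing_mat_iff)
qed

text \<open>On the moments of a point the quadratic form is the value of \<open>q\<close> there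
  times a square.\<close>

lemma psd_localizing_mat_monom_val:
  assumes "mpoly_eval q x \<ge> 0"
  shows "psd (localizing_mat k q (monom_val x))"
proof -
  let ?I = "mindices (k - half_deg q)"
  have "tms_pair q (\<lambda>\<kappa>. monom_val x (\<kappa> + \<alpha> + \<beta>))
      = mpoly_eval q x * (monom_val x \<alpha> * monom_val x \<beta>)" for \<alpha> \<beta>
    by (simp add: monom_val_add mult.assoc tms_pair_mult_right mpoly_eval_tms_pair)
  then have "(\<Sum>\<alpha>\<in>?I. \<Sum>\<beta>\<in>?I. v \<alpha> * tms_pair q (\<lambda>\<kappa>. monom_val x (\<kappa> + \<alpha> + \<beta>)) * v \<beta>)
      = mpoly_eval q x * (\<Sum>\<alpha>\<in>?I. v \<alpha> * monom_val x \<alpha>)\<^sup>2" for v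
    by (simp add: power2_eq_square sum_product sum_distrib_left mult_ac)
  then show ?thesis
    using assms by (simp add: psd_localizing_mat_iff)
qed

lemma psd_localizing_mat_midpoint:
  assumes "psd (localizing_mat k q y)" "psd (localizing_mat k q z)"
  shows "psd (localizing_mat k q (\<lambda>\<alpha>. (y \<alpha> + z \<alpha>) / 2))"
proof -
  let ?I = "mindices (k - half_deg q)"
  let ?Q = "\<lambda>y v. \<Sum>\<alpha>\<in>?I. \<Sum>\<beta>\<in>?I. v \<alpha> * tms_pair q (\<lambda>\<kappa>. y (\<kappa> + \<alpha> + \<beta>)) * v \<beta>"
  have mid: "?Q (\<lambda>\<alpha>. (y \<alpha> + z \<alpha>) / 2) v = (?Q y v + ?Q z v) / 2" for v
    by (simp only: tms_pair_midpoint)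
       (simp add: distrib_left distrib_right add_divide_distrib sum.distrib sum_divide_distrib)
  show ?thesis
    using assms unfolding psd_localizing_mat_iff mid by simp
qed

text \<open>Testing with the unit vector at index 0 picks out the (0,0) entry, which is the pairing
  itself.\<close>

lemma psd_localizing_mat_imp_tms_pair_nonneg:
  assumes "psd (localizing_mat k q y)"
  shows "tms_pair q y \<ge> 0"
proof -
  let ?I = "mindices (k - half_deg q)"
  let ?v = "\<lambda>\<alpha>. if \<alpha> = 0 then 1 else 0 :: real"
  have "(\<Sum>\<alpha>\<in>?I. \<Sum>\<beta>\<in>?I. ?v \<alpha> * tms_pair q (\<lambda>\<kappa>. y (\<kappa> + \<alpha> + \<beta>)) * ?v \<beta>)
     = (\<Sum>\<alpha>\<in>?I. if \<alpha> = 0 then \<Sum>\<beta>\<in>?I. if \<beta> = 0 then tms_pair q (\<lambda>\<kappa>. y (\<kappa> + \<alpha> + \<beta>)) else 0 else 0)"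
    by (intro sum.cong refl) (auto intro!: sum.cong)
  also have "\<dots> = tms_pair q y"
    by (simp add: finite_mindices)
  finally show ?thesis
    using assms[unfolded psd_localizing_mat_iff, rule_format, of ?v] by simp
qed

section \<open>The relaxation\<close>

text \<open>The equality case of the triangle inequality: it makes \<open>y\<close> and
  \<open>z\<close> proportional, and the common entry 1 at \<open>\<zeta>\<close> fixes the ratio to
  1.\<close>

lemma L2_set_midpoint_imp_eq:
  assumes I: "finite I" and z: "\<zeta> \<in> I" "y \<zeta> = 1" "z \<zeta> = 1"
    and le: "L2_set y I + L2_set z I \<le> 2 * L2_set (\<lambda>\<alpha>. (y \<alpha> + z \<alpha>) / 2) I"
    and "\<alpha> \<in> I"
  shows "y \<alpha> = z \<alpha>"
proof -
  define a b where "a = L2_set y I" and "b = L2_set z I"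
  have pos: "a \<ge> 0" "b \<ge> 0" by (simp_all add: a_def b_def)
  have sq: "(L2_set h I)\<^sup>2 = (\<Sum>\<alpha>\<in>I. (h \<alpha>)\<^sup>2)" for h
    by (simp add: L2_set_def sum_nonneg)
  let ?S = "\<Sum>\<alpha>\<in>I. y \<alpha> * z \<alpha>"
  have "(a + b)\<^sup>2 \<le> (2 * L2_set (\<lambda>\<alpha>. (y \<alpha> + z \<alpha>) / 2) I)\<^sup>2"
    using le pos unfolding a_def b_def by (intro power_mono) auto
  also have "\<dots> = (\<Sum>\<alpha>\<in>I. (y \<alpha> + z \<alpha>)\<^sup>2)"
    by (simp add: power_mult_distrib sq sum_distrib_left power_divide)
  also have "\<dots> = a\<^sup>2 + b\<^sup>2 + 2 * ?S"
    by (simp add: a_def b_def sq power2_sum sum.distrib sum_distrib_left mult.assoc)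
  \<comment> \<open>This is the Cauchy-Schwarz inequality reversed.\<close>
  finally have S: "a * b \<le> ?S"
    by (simp add: power2_sum)
  \<comment> \<open>The defect from proportionality is a sum of squares equal to
    \<open>2 * (a * b) * (a * b - ?S)\<close>, hence at most 0.\<close>
  have "(\<Sum>\<alpha>\<in>I. (b * y \<alpha> - a * z \<alpha>)\<^sup>2)
      = (\<Sum>\<alpha>\<in>I. b\<^sup>2 * (y \<alpha>)\<^sup>2 + a\<^sup>2 * (z \<alpha>)\<^sup>2 - 2 * (a * b) * (y \<alpha> * z \<alpha>))"
    by (intro sum.cong refl) (simp add: power2_diff power_mult_distrib mult_ac)
  also have "\<dots> = b\<^sup>2 * a\<^sup>2 + a\<^sup>2 * b\<^sup>2 - 2 * (a * b) * ?S"
    by (simp add: a_def b_def sq sum.distrib sum_subtractf sum_distrib_left)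
  also have "\<dots> = 2 * (a * b) * (a * b - ?S)"
    by (simp add: algebra_simps power2_eq_square)
  also have "\<dots> \<le> 0"
    using S pos by (intro mult_nonneg_nonpos) auto
  finally have "(\<Sum>\<alpha>\<in>I. (b * y \<alpha> - a * z \<alpha>)\<^sup>2) = 0"
    by (simp add: antisym sum_nonneg)
  then have eq: "b * y \<beta> = a * z \<beta>" if "\<beta> \<in> I" for \<beta>
    using I that by (simp add: sum_nonneg_eq_0_iff)
  have "a = b"
    using eq[OF z(1)] z by simp
  moreover have "a \<noteq> 0"
    using member_le_L2_set[OF I z(1), of y] z by (auto simp: a_def)
  ultimately show ?thesis
    using eq[OF \<open>\<alpha> \<in> I\<close>] by simp
qed

text \<open>Turns tightness, an equality of infima in \<open>ereal\<close>, into an equality of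
  attained values.\<close>

lemma is_arg_min_imp_opt_val:
  assumes "is_arg_min h (\<lambda>z. z \<in> S) x"
  shows "opt_val h S = ereal (h x)"
  using assms unfolding opt_val_def is_arg_min_linorder
  by (intro antisym INF_lower INF_greatest) auto

section \<open>Compactness of the simplex and solvability of \<open>(P)\<close>\<close>

lemma zero_mem_feas_P: "0 \<in> feas_P"
  by (simp add: feas_P_def)

lemma compact_feas_P: "compact (feas_P :: (real ^ 'm) set)"
proof -
  have "feas_P = (\<Inter>i. {x :: real ^ 'm. 0 \<le> x $ i}) \<inter> {x. (\<Sum>i\<in>UNIV. x $ i) \<le> 1}"
    by (auto simp: feas_P_def)
  also have "closed \<dots>"
    by (intro closed_Int closed_INT ballI closed_Collect_le continuous_intros)
  finally have "closed (feas_P :: (real ^ 'm) set)" .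
  \<comment> \<open>A nonnegative coordinate is at most the sum of all of them, hence at most
    1.\<close>
  moreover have "feas_P \<subseteq> cbox 0 (1 :: real ^ 'm)"
  proof
    fix x :: "real ^ 'm" assume x: "x \<in> feas_P"
    have "x $ i \<le> (\<Sum>i\<in>UNIV. x $ i)" for i
      by (rule member_le_sum) (use x in \<open>auto simp: feas_P_def\<close>)
    then show "x \<in> cbox 0 1"
      using x by (auto simp: feas_P_def mem_box_cart intro: order_trans)
  qed
  ultimately show ?thesis
    using bounded_subset[OF bounded_cbox] compact_eq_bounded_closed by blast
qed

lemma continuous_on_obj_P: "continuous_on S (obj_P f k \<epsilon>)"
  unfolding obj_P_def[abs_def] mpoly_eval_def monom_val_def L2_set_def
  by (intro continuous_intros)

lemma obj_P_has_arg_min: "\<exists>x. is_arg_min (obj_P f k \<epsilon>) (\<lambda>x. x \<in> feas_P) x"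
  using continuous_attains_inf[OF compact_feas_P _ continuous_on_obj_P] zero_mem_feas_P
  unfolding is_arg_min_linorder by blast

section \<open>Constructing feasible points of \<open>(R)\<close>\<close>

lemma obj_R_cong:
  assumes "mpoly_deg f \<le> 2 * k" "\<And>\<alpha>. \<alpha> \<in> mindices (2 * k) \<Longrightarrow> y \<alpha> = z \<alpha>"
  shows "obj_R f k \<epsilon> y = obj_R f k \<epsilon> z"
proof -
  have "tms_pair f y = tms_pair f z"
    by (rule tms_pair_cong) (use keys_subset_mindices[OF assms(1)] assms(2) in auto)
  moreover have "L2_set y (mindices (2 * k)) = L2_set z (mindices (2 * k))"
    using assms(2) by (intro L2_set_cong) auto
  ultimately show ?thesis by (simp add: obj_R_def)
qed

lemma obj_R_monom_val: "obj_R f k \<epsilon> (monom_val x) = obj_P f k \<epsilon> x"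
  by (simp add: obj_R_def obj_P_def mpoly_eval_tms_pair)

text \<open>Members of \<open>feas_R\<close> must be \<open>undefined\<close> beyond degree
  \<open>2 * k\<close>, while moments are given by a formula on all multi-indices; cutting them off
  changes none of the matrices.\<close>

lemma restrict_mem_feas_R:
  assumes "k \<ge> 1" "y 0 = 1" "psd (moment_mat k y)" "\<And>j. psd (localizing_mat k (g_poly j) y)"
  shows "restrict y (mindices (2 * k)) \<in> feas_R k"
proof -
  have "psd (localizing_mat k q (restrict y (mindices (2 * k))))"
    if "half_deg q \<le> k" "psd (localizing_mat k q y)" for q
    using that psd_localizing_mat_cong[OF that(1), of "restrict y (mindices (2 * k))" y] by simp
  then show ?thesis
    using assms le_trans[OF half_deg_g_poly_le \<open>k \<ge> 1\<close>]
    by (auto simp: feas_R_def tms_def moment_mat_def half_deg_one)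
qed

lemma moments_mem_feas_R:
  assumes "k \<ge> 1" "x \<in> feas_P"
  shows "restrict (monom_val x) (mindices (2 * k)) \<in> feas_R k"
proof (rule restrict_mem_feas_R)
  show "psd (localizing_mat k (g_poly j) (monom_val x))" for j
    by (rule psd_localizing_mat_monom_val)
       (use assms in \<open>auto simp: mpoly_eval_g_poly complete_vec_def feas_P_def split: option.split\<close>)
qed (use assms in \<open>simp_all add: moment_mat_def psd_localizing_mat_monom_val\<close>)

lemma midpoint_mem_feas_R:
  assumes "k \<ge> 1" "y \<in> feas_R k" "z \<in> feas_R k"
  shows "restrict (\<lambda>\<alpha>. (y \<alpha> + z \<alpha>) / 2) (mindices (2 * k)) \<in> feas_R k"
  by (rule restrict_mem_feas_R)
     (use assms in \<open>auto simp: feas_R_def moment_mat_def intro!: psd_localizing_mat_midpoint\<close>)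

text \<open>The midpoint of two minimizers is feasible, and the linear part of the objective is
  averaged exactly. Optimality thus leaves equality in the triangle inequality for the norm, after
  division by \<open>\<epsilon> > 0\<close>.\<close>

lemma obj_R_arg_min_unique:
  assumes f: "mpoly_deg f \<le> 2 * k" and k: "k \<ge> 1" and eps: "\<epsilon> > 0"
    and y: "is_arg_min (obj_R f k \<epsilon>) (\<lambda>y. y \<in> feas_R k) y"
    and z: "is_arg_min (obj_R f k \<epsilon>) (\<lambda>y. y \<in> feas_R k) z"
  shows "y = z"
proof -
  let ?I = "mindices (2 * k)" and ?m = "\<lambda>\<alpha>. (y \<alpha> + z \<alpha>) / 2"
  have yz: "y \<in> feas_R k" "z \<in> feas_R k" and
    eq: "obj_R f k \<epsilon> y = obj_R f k \<epsilon> z"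
    using y z by (auto simp: is_arg_min_linorder intro: antisym)
  have arith: "a + e * s + (b + e * t) \<le> 2 * ((a + b) / 2 + e * m) \<Longrightarrow>
      e * (s + t) \<le> e * (2 * m)" for a b e s t m :: real
    by (simp add: field_simps)
  have "obj_R f k \<epsilon> y \<le> obj_R f k \<epsilon> (restrict ?m ?I)"
    using y midpoint_mem_feas_R[OF k yz] by (simp add: is_arg_min_linorder)
  also have "\<dots> = obj_R f k \<epsilon> ?m"
    by (rule obj_R_cong[OF f]) simp
  finally have "obj_R f k \<epsilon> y + obj_R f k \<epsilon> z \<le> 2 * obj_R f k \<epsilon> ?m"
    using eq by simp
  then have "\<epsilon> * (L2_set y ?I + L2_set z ?I) \<le> \<epsilon> * (2 * L2_set ?m ?I)"
    unfolding obj_R_def tms_pair_midpoint by (rule arith)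
  then have le: "L2_set y ?I + L2_set z ?I \<le> 2 * L2_set ?m ?I"
    using eps by simp
  have "y \<alpha> = z \<alpha>" if "\<alpha> \<in> ?I" for \<alpha>
    by (rule L2_set_midpoint_imp_eq[OF finite_mindices zero_mem_mindices _ _ le that])
       (use yz in \<open>auto simp: feas_R_def\<close>)
  \<comment> \<open>Both sequences are \<open>undefined\<close> outside \<open>?I\<close>, so equal
    entries on \<open>?I\<close> give equality of functions.\<close>
  then show ?thesis
    using yz by (intro extensionalityI[of _ ?I]) (auto simp: feas_R_def tms_def)
qed

text \<open>The pivot is the (0,0) entry \<open>y 0 = 1\<close>; the row and the column through it
  are \<open>y\<close> itself on \<open>mindices k\<close>.\<close>

lemma mat_rank_moment_mat_eq_1_iff:
  assumes "y 0 = 1"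
  shows "mat_rank (moment_mat k y) = 1 \<longleftrightarrow>
    (\<forall>\<alpha>\<in>mindices k. \<forall>\<beta>\<in>mindices k. y (\<alpha> + \<beta>) = y \<alpha> * y \<beta>)"
  unfolding moment_mat_eq
  by (subst mat_rank_indexed_mat_eq_1_iff[OF finite_mindices, of 0]) (use assms in auto)

theorem moment_relaxation_tight_iff_rank_1:
  fixes f :: "'m::finite mpoly"
  assumes f: "mpoly_deg f \<le> 2 * k" and k: "k \<ge> 1" and eps: "\<epsilon> > 0"
    and y: "is_arg_min (obj_R f k \<epsilon>) (\<lambda>y. y \<in> feas_R k) y"
  shows "opt_val (obj_R f k \<epsilon>) (feas_R k) = opt_val (obj_P f k \<epsilon>) feas_P
           \<longleftrightarrow> mat_rank (moment_mat k y) = 1" (is ?tight)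
    and "mat_rank (moment_mat k y) = 1
           \<Longrightarrow> is_arg_min (obj_P f k \<epsilon>) (\<lambda>x. x \<in> feas_P) (\<chi> i. y (axis i 1))"
proof -
  let ?I = "mindices (2 * k) :: (nat ^ 'm) set"
  have yR: "y \<in> feas_R k" "y 0 = 1"
    using y by (auto simp: is_arg_min_linorder feas_R_def)
  have obj: "obj_R f k \<epsilon> (restrict (monom_val x) ?I) = obj_P f k \<epsilon> x" for x
    unfolding obj_R_monom_val[symmetric] by (rule obj_R_cong[OF f]) simp
  have lower: "obj_R f k \<epsilon> y \<le> obj_P f k \<epsilon> x" if "x \<in> feas_P" for x
    using y moments_mem_feas_R[OF k that] unfolding obj[symmetric] is_arg_min_linorder by simp
  \<comment> \<open>Under rank one the lower bound is attained at the point of first-order moments,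
    which gives its optimality and tightness together.\<close>
  have rank_1: "is_arg_min (obj_P f k \<epsilon>) (\<lambda>x. x \<in> feas_P) (\<chi> i. y (axis i 1)) \<and>
      obj_R f k \<epsilon> y = obj_P f k \<epsilon> (\<chi> i. y (axis i 1))"
    if "mat_rank (moment_mat k y) = 1"
  proof -
    let ?u = "\<chi> i. y (axis i 1)"
    have ymon: "y \<alpha> = monom_val ?u \<alpha>" if "\<alpha> \<in> ?I" for \<alpha>
      using mat_rank_moment_mat_eq_1_iff[of y, OF yR(2)] \<open>mat_rank (moment_mat k y) = 1\<close> that
      by (intro multiplicative_imp_monom_val[of y, OF yR(2) k]) blast+
    have eq: "obj_R f k \<epsilon> y = obj_P f k \<epsilon> ?u"
      unfolding obj_R_monom_val[symmetric] by (rule obj_R_cong[OF f ymon])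
    have "complete_vec ?u $ j \<ge> 0" for j
    proof -
      have "psd (localizing_mat k (g_poly j) y)"
        using yR by (simp add: feas_R_def)
      then have "psd (localizing_mat k (g_poly j) (monom_val ?u))"
        using psd_localizing_mat_cong[OF le_trans[OF half_deg_g_poly_le k], where y = y] ymon
        by blast
      then have "tms_pair (g_poly j) (monom_val ?u) \<ge> 0"
        by (rule psd_localizing_mat_imp_tms_pair_nonneg)
      then show ?thesis
        by (simp only: mpoly_eval_tms_pair[symmetric] mpoly_eval_g_poly)
    qed
    \<comment> \<open>\<open>None\<close> yields the bound on the coordinate sum,
      \<open>Some\<close> the signs of the coordinates.\<close>
    from this[of None] this[of "Some _"] have "?u \<in> feas_P"
      by (simp add: feas_P_def complete_vec_def)
    then show ?thesis
      using lower eq by (simp add: is_arg_min_linorder)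
  qed
  then show "is_arg_min (obj_P f k \<epsilon>) (\<lambda>x. x \<in> feas_P) (\<chi> i. y (axis i 1))"
    if "mat_rank (moment_mat k y) = 1"
    using that by blast
  show ?tight
  proof
    assume "mat_rank (moment_mat k y) = 1"
    then show "opt_val (obj_R f k \<epsilon>) (feas_R k) = opt_val (obj_P f k \<epsilon>) feas_P"
      using rank_1 is_arg_min_imp_opt_val[OF y] is_arg_min_imp_opt_val by metis
  next
    assume tight: "opt_val (obj_R f k \<epsilon>) (feas_R k) = opt_val (obj_P f k \<epsilon>) feas_P"
    obtain x where x: "is_arg_min (obj_P f k \<epsilon>) (\<lambda>x. x \<in> feas_P) x"
      using obj_P_has_arg_min by blast
    then have xP: "x \<in> feas_P" by (simp add: is_arg_min_linorder)
    \<comment> \<open>Both optimal values are attained, so tightness makes the truncated moments of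
      \<open>x\<close> optimal for \<open>(R)\<close>.\<close>
    have "obj_R f k \<epsilon> y = obj_R f k \<epsilon> (restrict (monom_val x) ?I)"
      using tight is_arg_min_imp_opt_val[OF y] is_arg_min_imp_opt_val[OF x] by (simp add: obj)
    then have "is_arg_min (obj_R f k \<epsilon>) (\<lambda>y. y \<in> feas_R k) (restrict (monom_val x) ?I)"
      using y moments_mem_feas_R[OF k xP] by (simp add: is_arg_min_linorder)
    then have "y = restrict (monom_val x) ?I"
      by (rule obj_R_arg_min_unique[OF f k eps y])
    then have "y \<alpha> = monom_val x \<alpha>" if "mdeg \<alpha> \<le> 2 * k" for \<alpha>
      using that by (simp add: mindices_def)
    then show "mat_rank (moment_mat k y) = 1"
      unfolding mat_rank_moment_mat_eq_1_iff[of y, OF yR(2)]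
      by (simp add: monom_val_add mindices_def mdeg_add)
  qed
qed

theorem theorem3p2:
  fixes M :: "'w measure"
    and X :: "'w \<Rightarrow> real ^ ('m::finite option)"
    and \<xi> :: "nat \<Rightarrow> real ^ ('m option)"
    and lam :: "nat \<Rightarrow> real"
    and d N d0 :: nat
    and f :: "'m mpoly"
    and \<epsilon> :: real
    and y_opt :: "nat ^ 'm \<Rightarrow> real"
  assumes "prob_space M"
    and "integrable M X"
    and "d \<ge> 2"
    and "\<forall>i\<in>{1..d}. lam i \<ge> 0"
    and "(\<Sum>i=1..d. lam i) = 1"
    and "N \<ge> 1"
    and "f = sample_avg_poly d lam (prob_space.expectation M X) N \<xi>"
    and "d0 = half_deg f"
    and "d0 \<ge> 1"
    and "\<epsilon> > 0"
    and "is_arg_min (obj_R f d0 \<epsilon>) (\<lambda>y. y \<in> feas_R d0) y_opt"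
  shows "(opt_val (obj_R f d0 \<epsilon>) (feas_R d0) = opt_val (obj_P f d0 \<epsilon>) feas_P
            \<longleftrightarrow> mat_rank (moment_mat d0 y_opt) = 1)
       \<and> (mat_rank (moment_mat d0 y_opt) = 1
            \<longrightarrow> is_arg_min (obj_P f d0 \<epsilon>) (\<lambda>x. x \<in> feas_P) (\<chi> i. y_opt (axis i 1)))"
proof -
  \<comment> \<open>The rounding up in \<open>half_deg\<close> guarantees that \<open>f\<close>
    pairs only with entries of degree at most \<open>2 * d0\<close>.\<close>
  have "mpoly_deg f \<le> 2 * d0"
    using mpoly_deg_le_half_deg \<open>d0 = half_deg f\<close> by simp
  from moment_relaxation_tight_iff_rank_1[OF this \<open>d0 \<ge> 1\<close> \<open>\<epsilon> > 0\<close> assms(11)]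
  show ?thesis by blast
qed

end
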